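(* Let $n\ge 1$, $\beta>0$, $\epsilon\in(0,1)$. Consider an experiment of $n$ sequential trials with random variables $(X_i,Y_i)$, $\mathrm{Past}_i$ ($1\le i\le n$) and a set $\mathcal M$ of allowed joint distributions, as described in the context. Fix one of the two choices: $U_i=X_i$ for all $i$, or $U_i=\mathbb E(X_i\mid \mathrm{Past}_i)$ for all $i$. For each $i$, let $T_i$ be an estimation factor of power $\beta$ for estimating $\mathbb 1[Y_i=1]\,U_i$ for the model $\mathcal M$ at trial $i$. Let $$S_U=\sum_{i=1}^n \mathbb 1[Y_i=1]\,U_i,\qquad S_{\mathrm{lb}}=\frac{\sum_{i=1}^n\ln(T_i)+\ln(\epsilon)}{\beta}.$$ Then for every allowed distribution in $\mathcal M$, $$\mathbb E\big(\mathbb 1[S_{\mathrm{lb}}\ge S_U]\,\big|\,\mathrm{Past}_1\big)\le\epsilon .$$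
   Context: All probability distributions are discrete (supported on a countable set). In trial $i$ there is a real random variable $X_i$ with $X_i\ge b$ for a known constant $b$, and a spot-checking random variable $Y_i\in\{0,1,2,\dots\}$; the trial is spot-checked (and $X_i$ observed) iff $Y_i=0$. $\mathrm{Past}_i$ is a random variable capturing everything instantiated before trial $i$: $\mathrm{Past}_i$ determines $\mathrm{Past}_{i-1}$, $X_{i-1}$, $Y_{i-1}$ for $i\ge2$; $\mathrm{Past}_1$ is the history prior to the experiment. Free-choice assumption: under each allowed distribution, $X_i$ and $Y_i$ are conditionally independent given $\mathrm{Past}_i$. A model $\mathcal M$ is a set of joint distributions of all these variables, called the allowed distributions. Conditional expectations take values in $(-\infty,+\infty]$; $e^{-\infty}=0$, $\ln 0=-\infty$. $\mathbb 1[\cdot]$ is the indicator function. An estimation factor of power $\beta>0$ for estimating $\mathbb 1[Y_i=1]U_i$ for model $\mathcal M$ at trial $i$ is a non-negative real function $T_i$ of $(\mathbb 1[Y_i=0]X_i,\,Y_i)$, which may also depend on $\mathrm{Past}_i$, such that for every allowed distribution in $\mathcal M$ $$\mathbb E\big(T_i\,e^{-\beta\,\mathbb 1[Y_i=1]\,U_i}\,\big|\,\mathrm{Past}_i\big)\le 1 .$$ *)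

theory Defs
  imports "HOL-Probability.Probability"
begin

text \<open>
  The logarithm of the library has value 0 at 0, and neither the logarithm nor the exponential
  is available on the extended reals; the conventions here are \<open>ln 0 = -\<infinity>\<close> and \<open>exp (-\<infinity>) = 0\<close>.
\<close>

definition exp_ereal :: "ereal \<Rightarrow> ereal" where
  "exp_ereal x = (case x of ereal r \<Rightarrow> ereal (exp r) | PInfty \<Rightarrow> \<infinity> | MInfty \<Rightarrow> 0)"

definition ln_nonneg :: "real \<Rightarrow> ereal" where
  "ln_nonneg t = (if t = 0 then -\<infinity> else ereal (ln t))"

text \<open>
  Expectation as the integral of the positive part minus that of the negative part
  (\<open>e2ennreal\<close> sends negative numbers to 0). It is meaningful for random variables
  that are almost surely bounded below, and then has a value in \<open>(-\<infinity>, \<infinity>]\<close>.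
\<close>

definition expectation_ereal :: "'w pmf \<Rightarrow> ('w \<Rightarrow> ereal) \<Rightarrow> ereal" where
  "expectation_ereal p Z =
     enn2ereal (\<integral>\<^sup>+ w. e2ennreal (Z w) \<partial>measure_pmf p) -
     enn2ereal (\<integral>\<^sup>+ w. e2ennreal (- Z w) \<partial>measure_pmf p)"

text \<open>
  The conditional distribution given the value that \<open>V\<close> takes at \<open>w\<close>, and the conditional
  expectation given \<open>V\<close> as a random variable. Both are meaningful only for \<open>w \<in> set_pmf \<mu>\<close>,
  that is, for values of \<open>V\<close> of positive probability. As distributions are discrete,
  a statement holds almost surely iff it holds for all \<open>w \<in> set_pmf \<mu>\<close>.
\<close>

definition cond_dist :: "'w pmf \<Rightarrow> ('w \<Rightarrow> 'v) \<Rightarrow> 'w \<Rightarrow> 'w pmf" where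
  "cond_dist \<mu> V w = cond_pmf \<mu> {w'. V w' = V w}"

definition cond_expectation :: "'w pmf \<Rightarrow> ('w \<Rightarrow> ereal) \<Rightarrow> ('w \<Rightarrow> 'v) \<Rightarrow> 'w \<Rightarrow> ereal" where
  "cond_expectation \<mu> Z V w = expectation_ereal (cond_dist \<mu> V w) Z"

definition cond_indep ::
  "'w pmf \<Rightarrow> ('w \<Rightarrow> real) \<Rightarrow> ('w \<Rightarrow> nat) \<Rightarrow> ('w \<Rightarrow> 'v) \<Rightarrow> bool" where
  "cond_indep \<mu> X Y V \<longleftrightarrow>
     (\<forall>w\<in>set_pmf \<mu>. prob_space.indep_var (measure_pmf (cond_dist \<mu> V w))
                        borel X (count_space UNIV) Y)"

definition determines :: "'w pmf \<Rightarrow> ('w \<Rightarrow> 'u) \<Rightarrow> ('w \<Rightarrow> 'v) \<Rightarrow> bool" where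
  "determines \<mu> V W \<longleftrightarrow> (\<exists>f. AE w in measure_pmf \<mu>. W w = f (V w))"

text \<open>
  Trials are numbered \<open>1, \<dots>, n\<close>. The variables \<open>X i\<close>, \<open>Y i\<close>, \<open>Past i\<close> live on one sample space
  \<open>'w\<close>, and an allowed distribution is a discrete distribution on it. The histories of all
  trials are coded in one type \<open>'p\<close>.
\<close>

definition spot_checking_experiment ::
  "nat \<Rightarrow> real \<Rightarrow> 'w pmf set \<Rightarrow> (nat \<Rightarrow> 'w \<Rightarrow> real) \<Rightarrow> (nat \<Rightarrow> 'w \<Rightarrow> nat) \<Rightarrow> (nat \<Rightarrow> 'w \<Rightarrow> 'p) \<Rightarrow> bool"
where
  "spot_checking_experiment n b M X Y Past \<longleftrightarrow>
     (\<forall>\<mu>\<in>M.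
        (\<forall>i\<in>{1..n}. AE w in measure_pmf \<mu>. b \<le> X i w) \<and>
        (\<forall>i\<in>{1..n}. cond_indep \<mu> (X i) (Y i) (Past i)) \<and>
        (\<forall>i\<in>{2..n}. determines \<mu> (Past i) (Past (i - 1)) \<and>
                     determines \<mu> (Past i) (X (i - 1)) \<and>
                     determines \<mu> (Past i) (Y (i - 1))))"

text \<open>
  The observed data of one trial are \<open>\<one>[Y = 0] X\<close> and \<open>Y\<close>. The estimated variable \<open>U\<close> may depend
  on the distribution, as the conditional expectation of \<open>X\<close> does; the function \<open>T\<close> may not.
\<close>

definition factor_value ::
  "('p \<Rightarrow> real \<Rightarrow> nat \<Rightarrow> real) \<Rightarrow> ('w \<Rightarrow> real) \<Rightarrow> ('w \<Rightarrow> nat) \<Rightarrow> ('w \<Rightarrow> 'p) \<Rightarrow> 'w \<Rightarrow> real" where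
  "factor_value T X Y Past w = T (Past w) (of_bool (Y w = 0) * X w) (Y w)"

definition estimation_factor ::
  "real \<Rightarrow> 'w pmf set \<Rightarrow> ('w \<Rightarrow> real) \<Rightarrow> ('w \<Rightarrow> nat) \<Rightarrow> ('w \<Rightarrow> 'p) \<Rightarrow> ('w pmf \<Rightarrow> 'w \<Rightarrow> ereal) \<Rightarrow>
   ('p \<Rightarrow> real \<Rightarrow> nat \<Rightarrow> real) \<Rightarrow> bool"
where
  "estimation_factor \<beta> M X Y Past U T \<longleftrightarrow>
     \<beta> > 0 \<and>
     (\<forall>h z y. 0 \<le> T h z y) \<and>
     (\<forall>\<mu>\<in>M. \<forall>w\<in>set_pmf \<mu>.
        cond_expectation \<mu>
          (\<lambda>w. ereal (factor_value T X Y Past w) *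
                exp_ereal (- (ereal \<beta> * (of_bool (Y w = 1) * U \<mu> w))))
          Past w \<le> 1)"

definition S_U :: "nat \<Rightarrow> (nat \<Rightarrow> 'w \<Rightarrow> nat) \<Rightarrow> (nat \<Rightarrow> 'w pmf \<Rightarrow> 'w \<Rightarrow> ereal) \<Rightarrow> 'w pmf \<Rightarrow> 'w \<Rightarrow> ereal"
where
  "S_U n Y U \<mu> w = (\<Sum>i=1..n. of_bool (Y i w = 1) * U i \<mu> w)"

definition S_lb ::
  "nat \<Rightarrow> real \<Rightarrow> real \<Rightarrow> (nat \<Rightarrow> 'w \<Rightarrow> real) \<Rightarrow> (nat \<Rightarrow> 'w \<Rightarrow> nat) \<Rightarrow> (nat \<Rightarrow> 'w \<Rightarrow> 'p) \<Rightarrow>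
   (nat \<Rightarrow> 'p \<Rightarrow> real \<Rightarrow> nat \<Rightarrow> real) \<Rightarrow> 'w \<Rightarrow> ereal"
where
  "S_lb n \<beta> \<epsilon> X Y Past T w =
     ((\<Sum>i=1..n. ln_nonneg (factor_value (T i) (X i) (Y i) (Past i) w)) + ereal (ln \<epsilon>)) / ereal \<beta>"

end

theory Submission
  imports Defs
begin

text \<open>
  Put \<open>F\<^sub>i = T\<^sub>i exp (- \<beta> \<one>[Y\<^sub>i = 1] U\<^sub>i)\<close>. As \<open>F\<^sub>1, \<dots>, F\<^sub>k\<close> and \<open>Past\<^sub>1\<close> are functions of
  \<open>Past\<^sub>k\<^sub>+\<^sub>1\<close>, the hypothesis \<open>E (F\<^sub>k\<^sub>+\<^sub>1 | Past\<^sub>k\<^sub>+\<^sub>1) \<le> 1\<close> shows by induction that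
  \<open>E (F\<^sub>1 \<cdots> F\<^sub>k | Past\<^sub>1) \<le> 1\<close>. The event \<open>S\<^sub>l\<^sub>b \<ge> S\<^sub>U\<close> is contained in
  \<open>F\<^sub>1 \<cdots> F\<^sub>n \<ge> 1 / \<epsilon>\<close>, so Markov's inequality gives the claim.
\<close>

section \<open>Conditioning on a discrete random variable\<close>

lemma determines_iff:
  "determines \<mu> V W \<longleftrightarrow> (\<forall>w\<in>set_pmf \<mu>. \<forall>w'\<in>set_pmf \<mu>. V w = V w' \<longrightarrow> W w = W w')"
proof
  assume "determines \<mu> V W"
  then show "\<forall>w\<in>set_pmf \<mu>. \<forall>w'\<in>set_pmf \<mu>. V w = V w' \<longrightarrow> W w = W w'"
    by (auto simp: determines_def AE_measure_pmf_iff)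
next
  assume *: "\<forall>w\<in>set_pmf \<mu>. \<forall>w'\<in>set_pmf \<mu>. V w = V w' \<longrightarrow> W w = W w'"
  \<comment> \<open>One representative of each fibre of \<open>V\<close> is chosen inside the
    support. For a value that \<open>V\<close> does not take on the support, \<open>f\<close> is
    arbitrary, which is harmless for an almost sure statement.\<close>
  define f where "f v = W (SOME w. w \<in> set_pmf \<mu> \<and> V w = v)" for v
  have "W w = f (V w)" if w: "w \<in> set_pmf \<mu>" for w
  proof -
    have "(SOME w'. w' \<in> set_pmf \<mu> \<and> V w' = V w) \<in> set_pmf \<mu> \<and>
          V (SOME w'. w' \<in> set_pmf \<mu> \<and> V w' = V w) = V w"
      by (rule someI[of _ w]) (use w in simp)
    then show ?thesis
      using * w unfolding f_def by metis
  qed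
  then show "determines \<mu> V W"
    by (auto simp: determines_def AE_measure_pmf_iff)
qed

lemma set_cond_dist:
  assumes "w \<in> set_pmf \<mu>"
  shows "set_pmf (cond_dist \<mu> V w) = {w' \<in> set_pmf \<mu>. V w' = V w}"
proof -
  have "set_pmf \<mu> \<inter> {w'. V w' = V w} \<noteq> {}"
    using assms by auto
  then show ?thesis
    by (auto simp: cond_dist_def)
qed

text \<open>The law of total probability: drawing \<open>w\<close> from \<mu> and then redrawing it
  within its fibre of \<open>V\<close> leaves \<mu> unchanged.\<close>

lemma bind_cond_dist: "bind_pmf \<mu> (cond_dist \<mu> V) = \<mu>"
proof -
  have "bind_pmf \<mu> (\<lambda>w. cond_pmf \<mu> {w'. V w' = V w}) = \<mu>"
    by (rule bind_cond_pmf_cancel) (auto intro!: arg_cong[where f = "measure_pmf.prob \<mu>"])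
  then show ?thesis
    by (simp add: cond_dist_def[abs_def])
qed

text \<open>On the fibre of \<open>w\<close> the conditional density is that of \<mu> divided by the
  probability of the fibre, and off it the density is 0. The product form avoids a division in
  \<open>ennreal\<close>.\<close>

lemma nn_integral_cond_dist:
  assumes "w \<in> set_pmf \<mu>"
  shows "(\<integral>\<^sup>+ w'. f w' \<partial>cond_dist \<mu> V w) * ennreal (measure_pmf.prob \<mu> {w'. V w' = V w}) =
         (\<integral>\<^sup>+ w'. indicator {w'. V w' = V w} w' * f w' \<partial>measure_pmf \<mu>)"
proof -
  let ?A = "{w'. V w' = V w}"
  have ne: "set_pmf \<mu> \<inter> ?A \<noteq> {}"
    using assms by auto
  then have pos: "measure_pmf.prob \<mu> ?A > 0"
    using assms by (metis (mono_tags, lifting) measure_pmf_posI mem_Collect_eq)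
  have "ennreal (pmf (cond_pmf \<mu> ?A) w') * ennreal (measure_pmf.prob \<mu> ?A)
      = ennreal (pmf \<mu> w') * indicator ?A w'" for w'
    using pos by (subst ennreal_mult[symmetric]) (auto simp: pmf_cond[OF ne])
  then show ?thesis
    unfolding cond_dist_def nn_integral_measure_pmf
    by (subst nn_integral_multc[symmetric]) (auto intro!: nn_integral_cong simp: ac_simps)
qed

text \<open>The tower property. \<open>H\<close> is constant on each fibre of \<open>V\<close>, so
  it leaves the inner conditional integral. No integrability condition arises, because all values
  lie in \<open>ennreal\<close>.\<close>

lemma nn_integral_mult_le_of_cond_le_1:
  fixes G H :: "'w \<Rightarrow> ennreal"
  assumes det: "determines \<mu> V H"
    and le: "\<And>w. w \<in> set_pmf \<mu> \<Longrightarrow> (\<integral>\<^sup>+ w'. G w' \<partial>cond_dist \<mu> V w) \<le> 1"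
  shows "(\<integral>\<^sup>+ w. H w * G w \<partial>measure_pmf \<mu>) \<le> (\<integral>\<^sup>+ w. H w \<partial>measure_pmf \<mu>)"
proof -
  have "(\<integral>\<^sup>+ w. H w * G w \<partial>measure_pmf \<mu>)
      = (\<integral>\<^sup>+ w. H w * G w \<partial>bind_pmf \<mu> (cond_dist \<mu> V))"
    by (simp only: bind_cond_dist)
  also have "\<dots> = (\<integral>\<^sup>+ w. (\<integral>\<^sup>+ w'. H w' * G w' \<partial>cond_dist \<mu> V w) \<partial>measure_pmf \<mu>)"
    by (rule nn_integral_bind_pmf)
  also have "\<dots> \<le> (\<integral>\<^sup>+ w. H w \<partial>measure_pmf \<mu>)"
  proof (intro nn_integral_mono_AE AE_pmfI)
    fix w assume w: "w \<in> set_pmf \<mu>"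
    have "(\<integral>\<^sup>+ w'. H w' * G w' \<partial>cond_dist \<mu> V w) = (\<integral>\<^sup>+ w'. H w * G w' \<partial>cond_dist \<mu> V w)"
    proof (intro nn_integral_cong_AE AE_pmfI)
      fix w' assume "w' \<in> set_pmf (cond_dist \<mu> V w)"
      then have "H w' = H w"
        using det w unfolding set_cond_dist[OF w] determines_iff by blast
      then show "H w' * G w' = H w * G w'"
        by simp
    qed
    also have "\<dots> = H w * (\<integral>\<^sup>+ w'. G w' \<partial>cond_dist \<mu> V w)"
      by (rule nn_integral_cmult) simp
    also have "\<dots> \<le> H w"
      using mult_left_mono[OF le[OF w], of "H w"] by simp
    finally show "(\<integral>\<^sup>+ w'. H w' * G w' \<partial>cond_dist \<mu> V w) \<le> H w" .
  qed
  finally show ?thesis .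
qed

section \<open>Expectations, logarithms and exponentials in the extended reals\<close>

lemma exp_ereal_nonneg: "0 \<le> exp_ereal x"
  by (cases x) (auto simp: exp_ereal_def)

lemma expectation_ereal_nonneg:
  assumes "\<And>w. 0 \<le> Z w"
  shows "expectation_ereal p Z = enn2ereal (\<integral>\<^sup>+ w. e2ennreal (Z w) \<partial>measure_pmf p)"
proof -
  have "e2ennreal (- Z w) = 0" for w
    using assms by (simp add: e2ennreal_neg)
  then show ?thesis
    by (simp add: expectation_ereal_def zero_ennreal.rep_eq)
qed

text \<open>The negative part integrates to at most \<open>- c\<close> and the positive part to at
  least 0. With \<open>c \<le> 0\<close>, the passage of \<open>- c\<close> through
  \<open>ennreal\<close> does not truncate it.\<close>

lemma expectation_ereal_lower_bound:
  assumes "\<And>w. w \<in> set_pmf p \<Longrightarrow> ereal c \<le> Z w" and "c \<le> 0"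
  shows "ereal c \<le> expectation_ereal p Z"
proof -
  have "(\<integral>\<^sup>+ w. e2ennreal (- Z w) \<partial>measure_pmf p) \<le> (\<integral>\<^sup>+ w. ennreal (- c) \<partial>measure_pmf p)"
  proof (intro nn_integral_mono_AE AE_pmfI)
    fix w assume "w \<in> set_pmf p"
    then have "- Z w \<le> ereal (- c)"
      using assms(1)[of w] ereal_minus_le_minus[of "Z w" "ereal c"] by simp
    then show "e2ennreal (- Z w) \<le> ennreal (- c)"
      by (metis e2ennreal_mono e2ennreal_ereal)
  qed
  then have "enn2ereal (\<integral>\<^sup>+ w. e2ennreal (- Z w) \<partial>measure_pmf p) \<le> enn2ereal (ennreal (- c))"
    by (simp add: less_eq_ennreal.rep_eq[symmetric])
  then have *: "enn2ereal (\<integral>\<^sup>+ w. e2ennreal (- Z w) \<partial>measure_pmf p) \<le> ereal (- c)"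
    using assms(2) by (simp add: enn2ereal_ennreal)
  have "0 - ereal (- c) \<le> expectation_ereal p Z"
    unfolding expectation_ereal_def by (rule ereal_minus_mono) (use * in auto)
  then show ?thesis
    by simp
qed

text \<open>The left sum cannot be \<open>-\<infinity>\<close> and the sum of logarithms cannot be
  \<open>\<infinity>\<close>, so the inequality between them forces both to be finite. Hence every
  \<open>u i\<close> is real and every \<open>t i\<close> is positive, and exponentiating is
  ordinary real arithmetic.\<close>

lemma prod_ge_of_sum_ln_ge:
  fixes t :: "nat \<Rightarrow> real" and u :: "nat \<Rightarrow> ereal"
  assumes "finite I" and "\<beta> > 0" and "\<epsilon> > 0"
    and t: "\<And>i. i \<in> I \<Longrightarrow> 0 \<le> t i" and u: "\<And>i. i \<in> I \<Longrightarrow> ereal c \<le> u i"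
    and le: "(\<Sum>i\<in>I. u i) \<le> ((\<Sum>i\<in>I. ln_nonneg (t i)) + ereal (ln \<epsilon>)) / ereal \<beta>"
  shows "1 \<le> ennreal \<epsilon> * (\<Prod>i\<in>I. e2ennreal (ereal (t i) * exp_ereal (- (ereal \<beta> * u i))))"
proof -
  have "(\<Sum>i\<in>I. ereal c) \<le> (\<Sum>i\<in>I. u i)"
    using u by (rule sum_mono)
  then have lo: "(\<Sum>i\<in>I. u i) \<noteq> -\<infinity>"
    by auto
  \<comment> \<open>The library value \<open>ln 0 = 0\<close> serves here as a finite upper bound
    for \<open>-\<infinity>\<close>.\<close>
  have "(\<Sum>i\<in>I. ln_nonneg (t i)) \<le> (\<Sum>i\<in>I. ereal (ln (t i)))"
    by (rule sum_mono) (simp add: ln_nonneg_def)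
  then have hi: "(\<Sum>i\<in>I. ln_nonneg (t i)) \<noteq> \<infinity>"
    by auto
  have fin: "\<bar>\<Sum>i\<in>I. u i\<bar> \<noteq> \<infinity>" "\<bar>\<Sum>i\<in>I. ln_nonneg (t i)\<bar> \<noteq> \<infinity>"
    using le lo hi \<open>\<beta> > 0\<close>
    by (cases "\<Sum>i\<in>I. u i"; cases "\<Sum>i\<in>I. ln_nonneg (t i)"; simp)+
  have uf: "\<bar>u i\<bar> \<noteq> \<infinity>" and tf: "\<bar>ln_nonneg (t i)\<bar> \<noteq> \<infinity>" if "i \<in> I" for i
    using fin that \<open>finite I\<close> by (auto simp: sum_Inf)
  define r where "r i = real_of_ereal (u i)" for i
  have ur: "u i = ereal (r i)" if "i \<in> I" for i
    using uf[OF that] by (auto simp: r_def ereal_real)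
  have tpos: "0 < t i" if "i \<in> I" for i
    using tf[OF that] t[OF that] by (auto simp: ln_nonneg_def split: if_splits)
  have "ereal (\<Sum>i\<in>I. r i) \<le> ereal (((\<Sum>i\<in>I. ln (t i)) + ln \<epsilon>) / \<beta>)"
  proof -
    have "(\<Sum>i\<in>I. ln_nonneg (t i)) = (\<Sum>i\<in>I. ereal (ln (t i)))"
      by (intro sum.cong) (auto simp: ln_nonneg_def dest: tpos)
    moreover have "(\<Sum>i\<in>I. u i) = (\<Sum>i\<in>I. ereal (r i))"
      using ur by (intro sum.cong) auto
    ultimately show ?thesis
      using le \<open>\<beta> > 0\<close> by simp
  qed
  then have "0 \<le> ln \<epsilon> + (\<Sum>i\<in>I. ln (t i) - \<beta> * r i)"
    using \<open>\<beta> > 0\<close> by (simp add: sum_subtractf sum_distrib_left[symmetric] field_simps)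
  then have "1 \<le> exp (ln \<epsilon> + (\<Sum>i\<in>I. ln (t i) - \<beta> * r i))"
    by simp
  also have "\<dots> = \<epsilon> * (\<Prod>i\<in>I. exp (ln (t i) - \<beta> * r i))"
    using \<open>\<epsilon> > 0\<close> \<open>finite I\<close> by (simp add: exp_add exp_sum)
  also have "(\<Prod>i\<in>I. exp (ln (t i) - \<beta> * r i)) = (\<Prod>i\<in>I. t i * exp (- (\<beta> * r i)))"
    using tpos by (intro prod.cong) (auto simp: exp_diff exp_minus field_simps)
  finally have "1 \<le> \<epsilon> * (\<Prod>i\<in>I. t i * exp (- (\<beta> * r i)))" .
  then have "1 \<le> ennreal (\<epsilon> * (\<Prod>i\<in>I. t i * exp (- (\<beta> * r i))))"
    by simp
  also have "\<dots> = ennreal \<epsilon> * (\<Prod>i\<in>I. ennreal (t i * exp (- (\<beta> * r i))))"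
    using \<open>\<epsilon> > 0\<close> t by (subst ennreal_mult) (auto intro!: prod_nonneg simp: prod_ennreal)
  also have "(\<Prod>i\<in>I. ennreal (t i * exp (- (\<beta> * r i)))) =
             (\<Prod>i\<in>I. e2ennreal (ereal (t i) * exp_ereal (- (ereal \<beta> * u i))))"
    using ur by (intro prod.cong) (auto simp: exp_ereal_def)
  finally show ?thesis .
qed

theorem theoremC1:
  fixes n :: nat and \<beta> \<epsilon> b :: real
    and M :: "'w pmf set"
    and X :: "nat \<Rightarrow> 'w \<Rightarrow> real"
    and Y :: "nat \<Rightarrow> 'w \<Rightarrow> nat"
    and Past :: "nat \<Rightarrow> 'w \<Rightarrow> 'p"
    and U :: "nat \<Rightarrow> 'w pmf \<Rightarrow> 'w \<Rightarrow> ereal"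
    and T :: "nat \<Rightarrow> 'p \<Rightarrow> real \<Rightarrow> nat \<Rightarrow> real"
  assumes "n \<ge> 1" and "\<beta> > 0" and "0 < \<epsilon>" and "\<epsilon> < 1"
    and "spot_checking_experiment n b M X Y Past"
    and "U = (\<lambda>i \<mu> w. ereal (X i w)) \<or>
         U = (\<lambda>i \<mu> w. cond_expectation \<mu> (\<lambda>w'. ereal (X i w')) (Past i) w)"
    and "\<And>i. i \<in> {1..n} \<Longrightarrow> estimation_factor \<beta> M (X i) (Y i) (Past i) (U i) (T i)"
  shows "\<forall>\<mu>\<in>M. \<forall>w\<in>set_pmf \<mu>.
           cond_expectation \<mu>
             (\<lambda>w'. of_bool (S_lb n \<beta> \<epsilon> X Y Past T w' \<ge> S_U n Y U \<mu> w'))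
             (Past 1) w \<le> ereal \<epsilon>"
proof (intro ballI)
  fix \<mu> w\<^sub>0 assume \<mu>: "\<mu> \<in> M" and w\<^sub>0: "w\<^sub>0 \<in> set_pmf \<mu>"
  define F where "F i w = ereal (factor_value (T i) (X i) (Y i) (Past i) w) *
                  exp_ereal (- (ereal \<beta> * (of_bool (Y i w = 1) * U i \<mu> w)))" for i w
  let ?G = "\<lambda>i w. e2ennreal (F i w)"
  \<comment> \<open>The event conditioned on. The induction works with unconditional integrals over
    \<open>?A\<close>; only afterwards is the probability of \<open>?A\<close> divided out.\<close>
  let ?A = "{w. Past 1 w = Past 1 w\<^sub>0}"
  let ?\<nu> = "cond_dist \<mu> (Past 1) w\<^sub>0"
  have T_nonneg: "0 \<le> factor_value (T i) (X i) (Y i) (Past i) w" if "i \<in> {1..n}" for i w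
    using assms(7)[OF that] by (simp add: estimation_factor_def factor_value_def)
  have F_nonneg: "0 \<le> F i w" if "i \<in> {1..n}" for i w
    using T_nonneg[OF that] by (simp add: F_def exp_ereal_nonneg)
  have cond_le: "(\<integral>\<^sup>+ w'. ?G i w' \<partial>cond_dist \<mu> (Past i) w) \<le> 1"
    if i: "i \<in> {1..n}" and w: "w \<in> set_pmf \<mu>" for i w
  proof -
    have "cond_expectation \<mu> (F i) (Past i) w \<le> 1"
      using assms(7)[OF i] \<mu> w by (simp add: estimation_factor_def F_def[abs_def])
    then show ?thesis
      using F_nonneg[OF i]
      \<comment> \<open>As \<open>F i\<close> is nonnegative, its extended-real expectation is a
        single \<open>ennreal\<close> integral, to which the tower property applies.\<close>
      by (simp add: cond_expectation_def expectation_ereal_nonneg less_eq_ennreal.rep_eq one_ennreal.rep_eq)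
  qed
  have step: "determines \<mu> (Past (Suc i)) (Past i)" "determines \<mu> (Past (Suc i)) (X i)"
      "determines \<mu> (Past (Suc i)) (Y i)" if "1 \<le> i" "i < n" for i
  proof -
    have "Suc i \<in> {2..n}"
      using that by auto
    then show "determines \<mu> (Past (Suc i)) (Past i)" "determines \<mu> (Past (Suc i)) (X i)"
      "determines \<mu> (Past (Suc i)) (Y i)"
      using assms(5) \<mu> unfolding spot_checking_experiment_def by (metis diff_Suc_1)+
  qed
  have past_F: "F i w = F i w'"
    if "1 \<le> i" "i < n" "w \<in> set_pmf \<mu>" "w' \<in> set_pmf \<mu>" "Past (Suc i) w = Past (Suc i) w'" for i w w'
  proof -
    have eq: "Past i w = Past i w'" "X i w = X i w'" "Y i w = Y i w'"
      using step[of i] that unfolding determines_iff by blast+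
    \<comment> \<open>If \<open>U\<close> is the conditional expectation, its value at
      \<open>w\<close> depends on \<open>w\<close> only through \<open>Past i w\<close>; otherwise
      it is \<open>X i\<close>.\<close>
    moreover from this have "U i \<mu> w = U i \<mu> w'"
      using assms(6) by (auto simp: cond_expectation_def cond_dist_def)
    ultimately show ?thesis
      by (simp add: F_def factor_value_def)
  qed
  \<comment> \<open>The weight for the tower property at trial \<open>Suc k\<close>. For
    \<open>k = 0\<close> the product is empty and \<open>Past 1\<close> alone decides
    \<open>?A\<close>. The bound \<open>k < n\<close> keeps \<open>Past (Suc k)\<close> among the
    histories of the \<open>n\<close> trials.\<close>
  have det: "determines \<mu> (Past (Suc k)) (\<lambda>w. indicator ?A w * (\<Prod>i=1..k. ?G i w))" if "k < n" for k
    using that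
  proof (induction k)
    case 0
    show ?case
      unfolding determines_iff by (simp add: indicator_def)
  next
    case (Suc k)
    have past: "determines \<mu> (Past (Suc (Suc k))) (Past (Suc k))"
      using step(1)[OF _ Suc.prems] by simp
    show ?case
      unfolding determines_iff
    proof (intro ballI impI)
      fix w w' assume w: "w \<in> set_pmf \<mu>" "w' \<in> set_pmf \<mu>" "Past (Suc (Suc k)) w = Past (Suc (Suc k)) w'"
      then have "Past (Suc k) w = Past (Suc k) w'"
        using past unfolding determines_iff by blast
      then have "indicator ?A w * (\<Prod>i=1..k. ?G i w) = indicator ?A w' * (\<Prod>i=1..k. ?G i w')"
        using Suc.IH[OF Suc_lessD[OF Suc.prems]] w(1,2) unfolding determines_iff by blast
      moreover have "F (Suc k) w = F (Suc k) w'"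
        using past_F[OF _ Suc.prems w] by simp
      ultimately show "indicator ?A w * (\<Prod>i=1..Suc k. ?G i w) = indicator ?A w' * (\<Prod>i=1..Suc k. ?G i w')"
        by (simp add: mult.assoc[symmetric])
    qed
  qed
  \<comment> \<open>The supermartingale bound: each further factor has conditional mean at most 1,
    so the integral over \<open>?A\<close> never exceeds its starting value, the probability of
    \<open>?A\<close>.\<close>
  have int_le: "(\<integral>\<^sup>+ w. indicator ?A w * (\<Prod>i=1..k. ?G i w) \<partial>measure_pmf \<mu>)
      \<le> ennreal (measure_pmf.prob \<mu> ?A)" if "k \<le> n" for k
    using that
  proof (induction k)
    case 0
    then show ?case
      by (simp add: measure_pmf.emeasure_eq_measure)
  next
    case (Suc k)
    have "(\<integral>\<^sup>+ w. indicator ?A w * (\<Prod>i=1..Suc k. ?G i w) \<partial>measure_pmf \<mu>)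
        = (\<integral>\<^sup>+ w. indicator ?A w * (\<Prod>i=1..k. ?G i w) * ?G (Suc k) w \<partial>measure_pmf \<mu>)"
      by (simp add: mult.assoc)
    also have "\<dots> \<le> (\<integral>\<^sup>+ w. indicator ?A w * (\<Prod>i=1..k. ?G i w) \<partial>measure_pmf \<mu>)"
      using Suc.prems by (intro nn_integral_mult_le_of_cond_le_1[OF det] cond_le) auto
    also have "\<dots> \<le> ennreal (measure_pmf.prob \<mu> ?A)"
      using Suc by simp
    finally show ?case .
  qed
  \<comment> \<open>The probability of \<open>?A\<close> can be cancelled: it is finite, and
    positive since \<open>w\<^sub>0\<close> lies in the support.\<close>
  have int_cond_le: "(\<integral>\<^sup>+ w. (\<Prod>i=1..n. ?G i w) \<partial>?\<nu>) \<le> 1"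
  proof -
    have pos: "measure_pmf.prob \<mu> ?A > 0"
      using w\<^sub>0 by (metis (mono_tags, lifting) measure_pmf_posI mem_Collect_eq)
    have "(\<integral>\<^sup>+ w. (\<Prod>i=1..n. ?G i w) \<partial>?\<nu>) * ennreal (measure_pmf.prob \<mu> ?A)
        \<le> 1 * ennreal (measure_pmf.prob \<mu> ?A)"
      using int_le[of n] by (simp add: nn_integral_cond_dist[OF w\<^sub>0])
    then have "ennreal (measure_pmf.prob \<mu> ?A) * (\<integral>\<^sup>+ w. (\<Prod>i=1..n. ?G i w) \<partial>?\<nu>)
        \<le> ennreal (measure_pmf.prob \<mu> ?A) * 1"
      by (simp only: mult.commute)
    then show ?thesis
      using pos by (subst (asm) ennreal_mult_le_mult_iff) simp_all
  qed
  \<comment> \<open>The minimum with 0 is taken because the indicator may turn the term into 0 while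
    \<open>b\<close> is positive. It also meets the sign condition of the lower bound for
    expectations.\<close>
  have U_ge: "ereal (min 0 b) \<le> of_bool (Y i w = 1) * U i \<mu> w"
    if i: "i \<in> {1..n}" and w: "w \<in> set_pmf \<mu>" for i w
  proof -
    have "AE w in measure_pmf \<mu>. b \<le> X i w"
      using bspec[OF assms(5)[unfolded spot_checking_experiment_def] \<mu>, THEN conjunct1] i by (rule bspec)
    then have X_ge: "ereal (min 0 b) \<le> ereal (X i w)" if "w \<in> set_pmf \<mu>" for w
      using that by (simp add: AE_measure_pmf_iff min.coboundedI2)
    have "ereal (min 0 b) \<le> expectation_ereal (cond_dist \<mu> (Past i) w) (\<lambda>w'. ereal (X i w'))"
      by (rule expectation_ereal_lower_bound) (simp_all only: set_cond_dist[OF w] X_ge mem_Collect_eq min.cobounded1)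
    with assms(6) X_ge[OF w] have "ereal (min 0 b) \<le> U i \<mu> w"
      by (elim disjE) (simp_all only: cond_expectation_def)
    then show ?thesis
      by (cases "Y i w = 1") (simp_all add: min.coboundedI1)
  qed
  \<comment> \<open>The pointwise form of Markov's inequality: the right side is at least 1 on the
    event, and nonnegative elsewhere.\<close>
  have event: "of_bool (S_lb n \<beta> \<epsilon> X Y Past T w \<ge> S_U n Y U \<mu> w) \<le> ennreal \<epsilon> * (\<Prod>i=1..n. ?G i w)"
    if "w \<in> set_pmf \<mu>" for w
  proof (cases "S_lb n \<beta> \<epsilon> X Y Past T w \<ge> S_U n Y U \<mu> w")
    case True
    note le = True[unfolded S_lb_def S_U_def]
    have "1 \<le> ennreal \<epsilon> * (\<Prod>i=1..n. ?G i w)"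
      unfolding F_def
      by (rule prod_ge_of_sum_ln_ge[OF finite_atLeastAtMost assms(2,3) _ _ le])
         (erule T_nonneg, erule U_ge[OF _ that])
    with True show ?thesis
      by simp
  qed simp
  have "(\<integral>\<^sup>+ w. of_bool (S_lb n \<beta> \<epsilon> X Y Past T w \<ge> S_U n Y U \<mu> w) \<partial>?\<nu>)
      \<le> (\<integral>\<^sup>+ w. ennreal \<epsilon> * (\<Prod>i=1..n. ?G i w) \<partial>?\<nu>)"
    using event w\<^sub>0 by (intro nn_integral_mono_AE) (auto simp: AE_measure_pmf_iff set_cond_dist)
  also have "\<dots> = ennreal \<epsilon> * (\<integral>\<^sup>+ w. (\<Prod>i=1..n. ?G i w) \<partial>?\<nu>)"
    by (rule nn_integral_cmult) simp
  also have "\<dots> \<le> ennreal \<epsilon>"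
    using mult_left_mono[OF int_cond_le, of "ennreal \<epsilon>"] by simp
  finally have "enn2ereal (\<integral>\<^sup>+ w. of_bool (S_lb n \<beta> \<epsilon> X Y Past T w \<ge> S_U n Y U \<mu> w) \<partial>?\<nu>) \<le> ereal \<epsilon>"
    using assms(3) by (simp add: less_eq_ennreal.rep_eq enn2ereal_ennreal)
  moreover have "e2ennreal (of_bool P) = of_bool P" for P
    by (cases P) (auto simp: one_ereal_def)
  ultimately show "cond_expectation \<mu>
      (\<lambda>w'. of_bool (S_lb n \<beta> \<epsilon> X Y Past T w' \<ge> S_U n Y U \<mu> w')) (Past 1) w\<^sub>0 \<le> ereal \<epsilon>"
    unfolding cond_expectation_def by (subst expectation_ereal_nonneg) simp_all
qed

end
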